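(* Let $p\geq 3$, let $E$ be a finite-dimensional real affine space, let $\mathcal{A}=(A_1,\dots,A_p)$ be an ordered family of $p$ distinct points of $E$, let $t\in(0,1)$, and let $\mathfrak{B}$ be the regular barypolygonal sequence of $\mathcal{A}$ with all parameters equal to $t$, i.e. $t_1=\dots=t_p=t$. Then the dual sequence $(G_m)_{m\in\mathbb{N}}$ of $\mathfrak{B}$ converges to the centroid $G$ of $\mathcal{A}$ (barycenter of $A_1,\dots,A_p$ with equal weights). Moreover, let $\alpha_p$ be the unique solution in $[0,1]$ of the equation $x^{p-1}+x-1=0$. Then the derived system $(t^{(m)})_{m\in\mathbb{N}}$ of $\mathfrak{B}$ satisfies: (i) if $t=1-\alpha_p$, it is stationary, equal to the vector of $\mathbb{R}^p$ all of whose coordinates are $1-\alpha_p$; (ii) if $t\neq 1-\alpha_p$, it diverges: the $p$ identical sequences $(t^{(2m)}_k)_{m\in\mathbb{N}}$, $1\leq k\leq p$, are monotone and converge to a common limit $\ell\in\{0,1\}$, and the $p$ identical sequences $(t^{(2m+1)}_k)_{m\in\mathbb{N}}$, $1\leq k\leq p$, are monotone in the direction opposite to that of the sequences $(t^{(2m)}_k)_{m\in\mathbb{N}}$ and converge to $1-\ell$.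
   Context: Let $p\geq 2$, let $\mathcal{A}=(A_1,\dots,A_p)$ be an ordered family of distinct points of a finite-dimensional real affine space $E$, and let $(t_1,\dots,t_p)\in(0,1)^p$. The $(t_1,\dots,t_p)$-barypolygone of an ordered family $(M_1,\dots,M_p)$ of points is the family $(N_1,\dots,N_p)$ where $N_k$ is the barycenter of $M_k$ with weight $t_k$ and $M_{k+1}$ with weight $1-t_k$ (indices cyclic, $M_{p+1}=M_1$). The $(t_1,\dots,t_p)$-barypolygonal sequence of $\mathcal{A}$ is $\mathfrak{B}=(\mathcal{B}_n)_{n\in\mathbb{N}}$ with $\mathcal{B}_0=\mathcal{A}$ and $\mathcal{B}_{n+1}$ the $(t_1,\dots,t_p)$-barypolygone of $\mathcal{B}_n$. It is called regular if $t_1=\dots=t_p$. It is known that all $p$ vertices of $\mathcal{B}_n$ converge, as $n\to\infty$, to the same point, the barycenter of the points $A_k$ with weights $\frac{1}{1-t_k}$ (equivalently with weights $\prod_{i\neq k}(1-t_i)$), $1\leq k\leq p$; this point is called the limit of $\mathfrak{B}$. The derived system of $\mathfrak{B}$ is the sequence $(t^{(m)})_{m\in\mathbb{N}}$ in $(0,1)^p$, $t^{(m)}=(t^{(m)}_1,\dots,t^{(m)}_p)$, defined by $t^{(0)}=(t_1,\dots,t_p)$ and $t^{(m+1)}_k=\prod_{1\leq i\leq p,\ i\neq k}\bigl(1-t^{(m)}_i\bigr)$ for $1\leq k\leq p$. The dual sequence of $\mathfrak{B}$ is $(G_m)_{m\in\mathbb{N}}$, where $G_m$ is the limit of the $t^{(m)}$-barypolygonal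 sequence of $\mathcal{A}$, i.e. the barycenter of the $A_k$ with weights $\frac{1}{1-t^{(m)}_k}$. A sequence is stationary if it is constant. *)

theory Defs
  imports "HOL-Analysis.Analysis"
begin

(* An ordered family of p points (or a vector of p reals) is a function on nat of which
   only the values at the indices 1, ..., p are meaningful. *)

definition cyc_succ :: "nat \<Rightarrow> nat \<Rightarrow> nat" where
  "cyc_succ p k = (if k = p then 1 else Suc k)"

definition barycenter :: "'i set \<Rightarrow> ('i \<Rightarrow> real) \<Rightarrow> ('i \<Rightarrow> 'a::real_vector) \<Rightarrow> 'a" where
  "barycenter I w A = (1 / (\<Sum>i\<in>I. w i)) *\<^sub>R (\<Sum>i\<in>I. w i *\<^sub>R A i)"

definition centroid :: "nat \<Rightarrow> (nat \<Rightarrow> 'a::real_vector) \<Rightarrow> 'a" where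
  "centroid p A = barycenter {1..p} (\<lambda>_. 1) A"

(* The weights t k and 1 - t k add up to 1, so no normalisation is needed. *)
definition barypolygone ::
    "nat \<Rightarrow> (nat \<Rightarrow> real) \<Rightarrow> (nat \<Rightarrow> 'a::real_vector) \<Rightarrow> nat \<Rightarrow> 'a" where
  "barypolygone p t M = (\<lambda>k. t k *\<^sub>R M k + (1 - t k) *\<^sub>R M (cyc_succ p k))"

primrec barypolygonal_seq ::
    "nat \<Rightarrow> (nat \<Rightarrow> real) \<Rightarrow> (nat \<Rightarrow> 'a::real_vector) \<Rightarrow> nat \<Rightarrow> nat \<Rightarrow> 'a" where
  "barypolygonal_seq p t A 0 = A"
| "barypolygonal_seq p t A (Suc n) = barypolygone p t (barypolygonal_seq p t A n)"

(* For p \<ge> 2 and parameters in (0,1) this point exists and is the barycenter of the A k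
   with weights 1 / (1 - t k). *)
definition barypolygonal_limit ::
    "nat \<Rightarrow> (nat \<Rightarrow> real) \<Rightarrow> (nat \<Rightarrow> 'a::real_normed_vector) \<Rightarrow> 'a" where
  "barypolygonal_limit p t A =
     (THE L. \<forall>k\<in>{1..p}. (\<lambda>n. barypolygonal_seq p t A n k) \<longlonglongrightarrow> L)"

primrec derived_system :: "nat \<Rightarrow> (nat \<Rightarrow> real) \<Rightarrow> nat \<Rightarrow> nat \<Rightarrow> real" where
  "derived_system p t 0 = t"
| "derived_system p t (Suc m) = (\<lambda>k. \<Prod>i\<in>{1..p} - {k}. 1 - derived_system p t m i)"

definition dual_seq ::
    "nat \<Rightarrow> (nat \<Rightarrow> real) \<Rightarrow> (nat \<Rightarrow> 'a::real_normed_vector) \<Rightarrow> nat \<Rightarrow> 'a" where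
  "dual_seq p t A m = barypolygonal_limit p (derived_system p t m) A"

(* Convergence in R^p, written coordinatewise. *)
definition tuple_tendsto :: "nat \<Rightarrow> (nat \<Rightarrow> nat \<Rightarrow> real) \<Rightarrow> (nat \<Rightarrow> real) \<Rightarrow> bool" where
  "tuple_tendsto p x v \<longleftrightarrow> (\<forall>k\<in>{1..p}. (\<lambda>m. x m k) \<longlonglongrightarrow> v k)"

definition alpha :: "nat \<Rightarrow> real" where
  "alpha p = (THE x. 0 \<le> x \<and> x \<le> 1 \<and> x ^ (p - 1) + x - 1 = 0)"

end

theory Submission
  imports Defs
begin

text \<open>
  For a regular sequence every tuple of the derived system is constant, and its common entry moves
  by \<open>f x = (1 - x) ^ q\<close> with \<open>q = p - 1\<close>. So every term of the dual sequence is the limit of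
  a regular barypolygonal sequence, and this limit is the centroid whatever the parameter in
  \<open>(0,1)\<close> is: one step preserves the sum of the vertices and lowers the sum of their squared
  norms by a multiple of the sum of the squared side lengths, so all sides shrink to zero
  (\<open>regular_barypolygonal_tendsto_centroid\<close>). Hence the dual sequence is constant.

  The derived system is thus the dynamics of the decreasing map \<open>f\<close> on \<open>(0,1)\<close>, whose only fixed
  point is \<open>1 - \<alpha>\<close>. The point to be settled is that \<open>f\<close> has no other cycle of length two, and in
  which direction \<open>f \<circ> f\<close> moves a point. With \<open>y = 1 - x\<close> and \<open>w = 1 - f x\<close> the number 1 is the
  average, with weights \<open>x\<close> and \<open>1 - x\<close>, of \<open>w^(q-1) * (1 + y + \<dots> + y^(q-1))\<close> and of the same
  expression with \<open>w\<close> and \<open>y\<close> exchanged, whereas \<open>f (f x)\<close> is \<open>x\<close> times the first expression.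
  Comparing the two expressions term by term shows that \<open>f (f x) - x\<close> and \<open>x - f x\<close> have the same
  sign (\<open>second_iterate_below\<close>, \<open>second_iterate_above\<close>). So the even iterates move
  monotonically away from \<open>1 - \<alpha>\<close>, towards the only fixed point of \<open>f \<circ> f\<close> left on their side,
  which is 0 or 1; the odd ones are their images under \<open>f\<close>.
\<close>

section \<open>Regular barypolygonal sequences\<close>

lemma bij_betw_cyc_succ:
  assumes "p \<ge> 1"
  shows "bij_betw (cyc_succ p) {1..p} {1..p}"
proof -
  have inj: "inj_on (cyc_succ p) {1..p}"
    by (auto simp: inj_on_def cyc_succ_def split: if_splits)
  moreover have "cyc_succ p ` {1..p} \<subseteq> {1..p}"
    using assms by (auto simp: cyc_succ_def)
  ultimately show ?thesis
    by (simp add: bij_betw_def endo_inj_surj)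
qed

lemma sum_cyc_succ:
  assumes "p \<ge> 1"
  shows "(\<Sum>k\<in>{1..p}. h (cyc_succ p k)) = (\<Sum>k\<in>{1..p}. h k)"
  by (rule sum.reindex_bij_betw[OF bij_betw_cyc_succ[OF assms]])

lemma norm_convex_combination_sq:
  fixes a b :: "'a::real_inner"
  shows "(norm (s *\<^sub>R a + (1 - s) *\<^sub>R b))\<^sup>2
    = s * (norm a)\<^sup>2 + (1 - s) * (norm b)\<^sup>2 - s * (1 - s) * (norm (a - b))\<^sup>2"
  by (simp add: power2_norm_eq_inner inner_simps inner_commute[of b a] algebra_simps)

context
  fixes p :: nat and \<tau> :: "nat \<Rightarrow> real" and s :: real and A :: "nat \<Rightarrow> 'a::real_inner"
  assumes p: "p \<ge> 1" and regular: "\<And>k. k \<in> {1..p} \<Longrightarrow> \<tau> k = s"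
begin

lemma barypolygonal_seq_Suc_regular:
  assumes "k \<in> {1..p}"
  shows "barypolygonal_seq p \<tau> A (Suc n) k = s *\<^sub>R barypolygonal_seq p \<tau> A n k
    + (1 - s) *\<^sub>R barypolygonal_seq p \<tau> A n (cyc_succ p k)"
  using regular[OF assms] by (simp add: barypolygone_def)

lemma sum_barypolygonal_seq:
  "(\<Sum>k\<in>{1..p}. barypolygonal_seq p \<tau> A n k) = (\<Sum>k\<in>{1..p}. A k)"
proof (induction n)
  case (Suc n)
  let ?M = "barypolygonal_seq p \<tau> A n"
  have "(\<Sum>k\<in>{1..p}. barypolygonal_seq p \<tau> A (Suc n) k)
      = (\<Sum>k\<in>{1..p}. s *\<^sub>R ?M k + (1 - s) *\<^sub>R ?M (cyc_succ p k))"
    by (rule sum.cong[OF refl barypolygonal_seq_Suc_regular])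
  also have "\<dots> = s *\<^sub>R (\<Sum>k\<in>{1..p}. ?M k) + (1 - s) *\<^sub>R (\<Sum>k\<in>{1..p}. ?M (cyc_succ p k))"
    by (simp only: sum.distrib scaleR_sum_right)
  also have "\<dots> = (\<Sum>k\<in>{1..p}. ?M k)"
    by (simp only: sum_cyc_succ[OF p, of ?M] scaleR_left_distrib[symmetric]) simp
  finally show ?case using Suc.IH by simp
qed simp

text \<open>
  The sum of squared norms is a Lyapunov function: it is nonnegative and its decrease in one step
  is \<open>s * (1 - s)\<close> times the sum of the squared side lengths, which therefore tends to zero.
\<close>

lemma side_tendsto_0:
  assumes s: "0 < s" "s < 1" and k: "k \<in> {1..p}"
  shows "(\<lambda>n. barypolygonal_seq p \<tau> A n k - barypolygonal_seq p \<tau> A n (cyc_succ p k)) \<longlonglongrightarrow> 0"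
proof -
  define M where "M = barypolygonal_seq p \<tau> A"
  define V where "V = (\<lambda>n. \<Sum>k\<in>{1..p}. (norm (M n k))\<^sup>2)"
  define D where "D = (\<lambda>n. \<Sum>k\<in>{1..p}. (norm (M n k - M n (cyc_succ p k)))\<^sup>2)"
  have step: "V (Suc n) = V n - s * (1 - s) * D n" for n
  proof -
    have "V (Suc n) = (\<Sum>k\<in>{1..p}. s * (norm (M n k))\<^sup>2 + (1 - s) * (norm (M n (cyc_succ p k)))\<^sup>2
        - s * (1 - s) * (norm (M n k - M n (cyc_succ p k)))\<^sup>2)"
      unfolding V_def M_def
      by (rule sum.cong[OF refl])
         (simp only: barypolygonal_seq_Suc_regular norm_convex_combination_sq)
    also have "\<dots> = s * V n + (1 - s) * (\<Sum>k\<in>{1..p}. (norm (M n (cyc_succ p k)))\<^sup>2)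
        - s * (1 - s) * D n"
      unfolding V_def D_def by (simp only: sum.distrib sum_subtractf sum_distrib_left)
    also have "(\<Sum>k\<in>{1..p}. (norm (M n (cyc_succ p k)))\<^sup>2) = V n"
      unfolding V_def by (rule sum_cyc_succ[OF p])
    finally show ?thesis by (simp add: algebra_simps)
  qed
  have D_nonneg: "D n \<ge> 0" for n unfolding D_def by (intro sum_nonneg) auto
  have V_nonneg: "V n \<ge> 0" for n unfolding V_def by (intro sum_nonneg) auto
  have "decseq V"
    using s D_nonneg by (intro decseq_SucI) (simp add: step)
  then obtain L where L: "V \<longlonglongrightarrow> L"
    using decseq_convergent[of V 0] V_nonneg by metis
  have "(\<lambda>n. (V n - V (Suc n)) / (s * (1 - s))) \<longlonglongrightarrow> (L - L) / (s * (1 - s))"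
    using s by (intro tendsto_intros L LIMSEQ_Suc[OF L]) auto
  moreover have "(V n - V (Suc n)) / (s * (1 - s)) = D n" for n
    using s by (simp add: step)
  ultimately have D: "D \<longlonglongrightarrow> 0" by simp
  have "(\<lambda>n. (norm (M n k - M n (cyc_succ p k)))\<^sup>2) \<longlonglongrightarrow> 0"
  proof (rule tendsto_sandwich[OF _ _ tendsto_const D])
    show "\<forall>\<^sub>F n in sequentially. (norm (M n k - M n (cyc_succ p k)))\<^sup>2 \<le> D n"
      unfolding D_def using k by (intro always_eventually allI member_le_sum) auto
  qed simp
  then have "(\<lambda>n. norm (M n k - M n (cyc_succ p k))) \<longlonglongrightarrow> 0"
    using tendsto_real_sqrt by fastforce
  then show ?thesis
    unfolding M_def by (rule tendsto_norm_zero_cancel)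
qed

lemma regular_barypolygonal_tendsto_centroid:
  assumes s: "0 < s" "s < 1" and k: "k \<in> {1..p}"
  shows "(\<lambda>n. barypolygonal_seq p \<tau> A n k) \<longlonglongrightarrow> centroid p A"
proof -
  define M where "M = barypolygonal_seq p \<tau> A"
  have diff: "(\<lambda>n. M n 1 - M n j) \<longlonglongrightarrow> 0" if "1 \<le> j" "j \<le> p" for j
    using that
  proof (induction j rule: dec_induct)
    case (step j)
    have "(\<lambda>n. (M n 1 - M n j) + (M n j - M n (cyc_succ p j))) \<longlonglongrightarrow> 0 + 0"
      using step side_tendsto_0[OF s, of j] unfolding M_def by (intro tendsto_add) auto
    then show ?case using step by (simp add: cyc_succ_def)
  qed simp
  have "(\<lambda>n. centroid p A + (1 / real p) *\<^sub>R (\<Sum>j\<in>{1..p}. M n 1 - M n j))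
      \<longlonglongrightarrow> centroid p A + (1 / real p) *\<^sub>R (\<Sum>j\<in>{1..p}. 0)"
    by (intro tendsto_intros diff) auto
  moreover have "centroid p A + (1 / real p) *\<^sub>R (\<Sum>j\<in>{1..p}. M n 1 - M n j) = M n 1" for n
  proof -
    have "(\<Sum>j\<in>{1..p}. M n 1 - M n j) = real p *\<^sub>R M n 1 - (\<Sum>j\<in>{1..p}. A j)"
      by (simp add: sum_subtractf M_def sum_barypolygonal_seq sum_constant_scaleR
        del: sum_constant One_nat_def)
    then show ?thesis
      using p by (simp add: centroid_def barycenter_def scaleR_diff_right)
  qed
  ultimately have one: "(\<lambda>n. M n 1) \<longlonglongrightarrow> centroid p A" by simp
  have "(\<lambda>n. M n 1 - (M n 1 - M n k)) \<longlonglongrightarrow> centroid p A - 0"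
    using k by (intro tendsto_diff one diff) auto
  then show ?thesis by (simp add: M_def)
qed

lemma regular_barypolygonal_limit:
  assumes "0 < s" "s < 1"
  shows "barypolygonal_limit p \<tau> A = centroid p A"
  unfolding barypolygonal_limit_def
proof (rule the_equality)
  show "\<forall>k\<in>{1..p}. (\<lambda>n. barypolygonal_seq p \<tau> A n k) \<longlonglongrightarrow> centroid p A"
    using regular_barypolygonal_tendsto_centroid[OF assms] by blast
next
  fix L assume L: "\<forall>k\<in>{1..p}. (\<lambda>n. barypolygonal_seq p \<tau> A n k) \<longlonglongrightarrow> L"
  have "1 \<in> {1..p}" using p by simp
  with L show "L = centroid p A"
    using LIMSEQ_unique regular_barypolygonal_tendsto_centroid[OF assms] by blast
qed

end

section \<open>The map \<open>x \<mapsto> (1 - x) ^ q\<close>\<close>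

definition complement_power :: "nat \<Rightarrow> real \<Rightarrow> real" where
  "complement_power q x = (1 - x) ^ q"

lemma complement_power_in_unit:
  assumes "0 < x" "x < 1" "q \<ge> 1"
  shows "0 < complement_power q x" "complement_power q x < 1"
  using assms by (simp_all add: complement_power_def power_less_one_iff)

lemma complement_power_antimono:
  assumes "x \<le> y" "y \<le> 1"
  shows "complement_power q y \<le> complement_power q x"
  using assms by (simp add: complement_power_def power_mono)

lemma complement_power_iterate_in_unit:
  assumes "0 < x" "x < 1" "q \<ge> 1"
  shows "0 < (complement_power q ^^ n) x \<and> (complement_power q ^^ n) x < 1"
  by (induction n) (use assms complement_power_in_unit in auto)

text \<open>
  After division by \<open>(w * y) ^ (q - 1)\<close> this compares two sums of powers of the inverses of
  \<open>y\<close> and \<open>w\<close>; the hypothesis \<open>q \<ge> 2\<close> makes one term comparison strict.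
\<close>

lemma power_times_geometric_sum_less:
  fixes w y :: real
  assumes "0 < w" "w < y" "q \<ge> 2"
  shows "w ^ (q - 1) * (\<Sum>i<q. y ^ i) < y ^ (q - 1) * (\<Sum>i<q. w ^ i)"
  unfolding sum_distrib_left
proof (rule sum_strict_mono_ex1)
  have split: "a ^ (q - 1) * b ^ i = (a * b) ^ i * a ^ (q - 1 - i)" if "i < q" for i and a b :: real
  proof -
    have "a ^ (q - 1) = a ^ i * a ^ (q - 1 - i)"
      using that by (simp flip: power_add)
    then show ?thesis by (simp add: power_mult_distrib)
  qed
  show "\<forall>i\<in>{..<q}. w ^ (q - 1) * y ^ i \<le> y ^ (q - 1) * w ^ i"
    using assms by (simp add: split mult.commute[of y w] mult_left_mono power_mono del: One_nat_def)
  have "w ^ (q - 1) < y ^ (q - 1)"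
    using assms by (intro power_strict_mono) auto
  then show "\<exists>i\<in>{..<q}. w ^ (q - 1) * y ^ i < y ^ (q - 1) * w ^ i"
    using assms by (intro bexI[of _ 0]) auto
qed simp

text \<open>
  Both equations come from summing the geometric series, since
  \<open>1 - y ^ q = w\<close> for \<open>y = 1 - x\<close> and \<open>1 - w = y ^ q\<close>. They exhibit 1 as a weighted average of
  the two expressions compared in \<open>power_times_geometric_sum_less\<close>.
\<close>

lemma second_iterate_average:
  fixes x w y :: real and q :: nat
  defines "y \<equiv> 1 - x" and "w \<equiv> 1 - complement_power q x"
  assumes "q \<ge> 1"
  shows "complement_power q (complement_power q x) = x * (w ^ (q - 1) * (\<Sum>i<q. y ^ i))"
    and "1 - complement_power q (complement_power q x) = (1 - x) * (y ^ (q - 1) * (\<Sum>i<q. w ^ i))"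
proof -
  have pow: "a ^ q = a * a ^ (q - 1)" for a :: real
    using assms(3) by (cases q) auto
  have w: "w = 1 - y ^ q" by (simp add: w_def y_def complement_power_def)
  have ff: "complement_power q (complement_power q x) = w ^ q"
    by (simp add: w_def complement_power_def)
  have "1 - y ^ q = (1 - y) * (\<Sum>i<q. y ^ i)"
    by (rule one_diff_power_eq)
  then have "w = x * (\<Sum>i<q. y ^ i)"
    by (simp add: w) (simp add: y_def)
  then have "w * w ^ (q - 1) = x * (\<Sum>i<q. y ^ i) * w ^ (q - 1)" by simp
  then show "complement_power q (complement_power q x) = x * (w ^ (q - 1) * (\<Sum>i<q. y ^ i))"
    by (simp add: ff pow mult_ac)
  have "1 - w ^ q = (1 - w) * (\<Sum>i<q. w ^ i)"
    by (rule one_diff_power_eq)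
  also have "1 - w = (1 - x) * y ^ (q - 1)"
    using pow[of y] by (simp add: w y_def)
  finally show "1 - complement_power q (complement_power q x)
      = (1 - x) * (y ^ (q - 1) * (\<Sum>i<q. w ^ i))"
    by (simp add: ff mult_ac)
qed

lemma second_iterate_below:
  assumes x: "0 < x" "x < 1" and q: "q \<ge> 2" and less: "x < complement_power q x"
  shows "complement_power q (complement_power q x) < x"
proof -
  define y w where "y = 1 - x" and "w = 1 - complement_power q x"
  define P Q where "P = w ^ (q - 1) * (\<Sum>i<q. y ^ i)" and "Q = y ^ (q - 1) * (\<Sum>i<q. w ^ i)"
  have "0 < w" using complement_power_in_unit(2)[OF x, of q] q by (simp add: w_def)
  then have "P < Q" unfolding P_def Q_def
    using less q by (intro power_times_geometric_sum_less) (auto simp: y_def w_def)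
  then have "(1 - x) * P < (1 - x) * Q" using x by simp
  moreover have eqs: "complement_power q (complement_power q x) = x * P"
      "1 - complement_power q (complement_power q x) = (1 - x) * Q"
    unfolding P_def Q_def y_def w_def using second_iterate_average[of q x] q by simp_all
  ultimately have "P < 1" by (simp add: algebra_simps)
  then show ?thesis using x eqs(1) by simp
qed

lemma second_iterate_above:
  assumes x: "0 < x" "x < 1" and q: "q \<ge> 2" and less: "complement_power q x < x"
  shows "x < complement_power q (complement_power q x)"
proof -
  define y w where "y = 1 - x" and "w = 1 - complement_power q x"
  define P Q where "P = w ^ (q - 1) * (\<Sum>i<q. y ^ i)" and "Q = y ^ (q - 1) * (\<Sum>i<q. w ^ i)"
  have "Q < P" unfolding P_def Q_def
    using x less q by (intro power_times_geometric_sum_less) (auto simp: y_def w_def)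
  then have "(1 - x) * Q < (1 - x) * P" using x by simp
  moreover have eqs: "complement_power q (complement_power q x) = x * P"
      "1 - complement_power q (complement_power q x) = (1 - x) * Q"
    unfolding P_def Q_def y_def w_def using second_iterate_average[of q x] q by simp_all
  ultimately have "1 < P" by (simp add: algebra_simps)
  then show ?thesis using x eqs(1) by simp
qed

lemma tendsto_complement_power:
  "(X \<longlongrightarrow> a) F \<Longrightarrow> ((\<lambda>n. complement_power q (X n)) \<longlongrightarrow> complement_power q a) F"
  unfolding complement_power_def by (intro tendsto_intros)

lemma limit_of_even_iterates_fixed:
  assumes "(\<lambda>m. (complement_power q ^^ (2 * m)) x) \<longlonglongrightarrow> L"
  shows "complement_power q (complement_power q L) = L"
proof (rule LIMSEQ_unique)
  show "(\<lambda>m. (complement_power q ^^ (2 * Suc m)) x) \<longlonglongrightarrow> L"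
    using LIMSEQ_Suc[OF assms] .
  show "(\<lambda>m. (complement_power q ^^ (2 * Suc m)) x) \<longlonglongrightarrow> complement_power q (complement_power q L)"
    using tendsto_complement_power[OF tendsto_complement_power[OF assms]] by simp
qed

text \<open>
  The condition \<open>x < f x\<close> survives when \<open>x\<close> decreases, because \<open>f\<close> is decreasing. So it holds
  along the even iterates and at their limit, where \<open>second_iterate_below\<close> excludes a positive
  fixed point of the second iterate.
\<close>

lemma even_iterates_below:
  assumes x: "0 < x" "x < 1" and q: "q \<ge> 2" and less: "x < complement_power q x"
  shows "decseq (\<lambda>m. (complement_power q ^^ (2 * m)) x)"
    and "(\<lambda>m. (complement_power q ^^ (2 * m)) x) \<longlonglongrightarrow> 0"
proof -
  define f where "f = complement_power q"
  define u where "u = (\<lambda>m. (f ^^ (2 * m)) x)"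
  have u_Suc: "u (Suc m) = f (f (u m))" for m by (simp add: u_def)
  have u_unit: "0 < u m" "u m < 1" for m
    using complement_power_iterate_in_unit[OF x, of q "2 * m"] q by (auto simp: u_def f_def)
  have u_less: "u m < f (u m)" for m
  proof (induction m)
    case 0
    then show ?case using less by (simp add: u_def f_def)
  next
    case (Suc m)
    have "u (Suc m) < u m"
      using second_iterate_below[OF u_unit q] Suc.IH by (simp add: u_Suc f_def)
    moreover from this have "f (u m) \<le> f (u (Suc m))"
      using u_unit[of m] by (simp add: f_def complement_power_antimono)
    ultimately show ?case using Suc.IH by linarith
  qed
  have dec: "decseq u"
  proof (rule decseq_SucI)
    fix m show "u (Suc m) \<le> u m"
      using second_iterate_below[OF u_unit q, of m] u_less[of m] by (simp add: u_Suc f_def)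
  qed
  then obtain L where L: "u \<longlonglongrightarrow> L" and L_le: "\<And>m. L \<le> u m"
    using decseq_convergent[of u 0] u_unit less_imp_le by metis
  have "L \<ge> 0" using LIMSEQ_le_const[OF L] u_unit less_imp_le by blast
  have "L \<le> x" using L_le[of 0] by (simp add: u_def)
  have "L = 0"
  proof (rule ccontr)
    assume "L \<noteq> 0"
    have "L < complement_power q L"
      using complement_power_antimono[OF \<open>L \<le> x\<close>, of q] x less \<open>L \<le> x\<close> by linarith
    then have "complement_power q (complement_power q L) < L"
      using \<open>L \<ge> 0\<close> \<open>L \<noteq> 0\<close> \<open>L \<le> x\<close> x q by (intro second_iterate_below) auto
    with limit_of_even_iterates_fixed[of q x L] L show False
      by (simp add: u_def f_def)
  qed
  with L dec show "decseq (\<lambda>m. (complement_power q ^^ (2 * m)) x)"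
    "(\<lambda>m. (complement_power q ^^ (2 * m)) x) \<longlonglongrightarrow> 0"
    by (simp_all add: u_def f_def)
qed

text \<open>
  The image of a point above the fixed point lies below it, so the iterates of the image are
  already understood; applying the map once more gives all even iterates except the starting point.
\<close>

lemma even_iterates_above:
  assumes x: "0 < x" "x < 1" and q: "q \<ge> 2" and less: "complement_power q x < x"
  shows "incseq (\<lambda>m. (complement_power q ^^ (2 * m)) x)"
    and "(\<lambda>m. (complement_power q ^^ (2 * m)) x) \<longlonglongrightarrow> 1"
proof -
  define f where "f = complement_power q"
  define u where "u = (\<lambda>m. (f ^^ (2 * m)) x)"
  define v where "v = (\<lambda>m. (f ^^ (2 * m)) (f x))"
  have fx: "0 < f x" "f x < 1"
    using complement_power_in_unit[OF x, of q] q by (auto simp: f_def)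
  have xff: "x < f (f x)"
    using second_iterate_above[OF x q less] by (simp add: f_def)
  then have "f x < f (f x)" using less by (simp add: f_def)
  then have v: "decseq v" "v \<longlonglongrightarrow> 0"
    using even_iterates_below[OF fx q] by (simp_all add: v_def f_def)
  have v_unit: "v m < 1" for m
    using complement_power_iterate_in_unit[OF fx, of q "2 * m"] q by (auto simp: v_def f_def)
  have u_Suc: "u (Suc m) = f (v m)" for m
    by (simp add: u_def v_def funpow_swap1)
  have "u m \<le> u (Suc m)" for m
  proof (cases m)
    case 0
    then show ?thesis using xff by (simp add: u_def numeral_2_eq_2)
  next
    case (Suc n)
    have "v m \<le> v n" using decseq_SucD[OF v(1)] Suc by simp
    then have "f (v n) \<le> f (v m)"
      using v_unit[of n] by (simp add: f_def complement_power_antimono)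
    then show ?thesis using Suc u_Suc by simp
  qed
  then show "incseq (\<lambda>m. (complement_power q ^^ (2 * m)) x)"
    by (intro incseq_SucI) (simp add: u_def f_def)
  have "(\<lambda>m. f (v m)) \<longlonglongrightarrow> f 0"
    unfolding f_def by (rule tendsto_complement_power[OF v(2)])
  then have "(\<lambda>m. u (Suc m)) \<longlonglongrightarrow> 1"
    by (simp add: u_Suc) (simp add: f_def complement_power_def)
  then have "u \<longlonglongrightarrow> 1" by (rule LIMSEQ_imp_Suc)
  then show "(\<lambda>m. (complement_power q ^^ (2 * m)) x) \<longlonglongrightarrow> 1"
    by (simp add: u_def f_def)
qed

section \<open>The root of \<open>x ^ q + x - 1\<close>\<close>

lemma power_plus_id_strict_mono:
  fixes x y :: real
  assumes "0 \<le> x" "x < y"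
  shows "x ^ q + x - 1 < y ^ q + y - 1"
  using power_mono[of x y q] assms by linarith

lemma ex1_root:
  assumes "q \<ge> 1"
  shows "\<exists>!x::real. 0 \<le> x \<and> x \<le> 1 \<and> x ^ q + x - 1 = 0"
proof -
  have "\<exists>x::real. 0 \<le> x \<and> x \<le> 1 \<and> x ^ q + x - 1 = 0"
    using assms by (intro IVT') (auto intro!: continuous_intros simp: power_0_left)
  moreover have "x = y" if "0 \<le> x \<and> x ^ q + x - 1 = 0" "0 \<le> y \<and> y ^ q + y - 1 = 0" for x y :: real
    using power_plus_id_strict_mono[of x y q] power_plus_id_strict_mono[of y x q] that
    by (cases x y rule: linorder_cases) auto
  ultimately show ?thesis by blast
qed

lemma complement_power_eq_iff_alpha:
  assumes "p \<ge> 2" "0 < x" "x < 1"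
  shows "complement_power (p - 1) x = x \<longleftrightarrow> x = 1 - alpha p"
proof -
  have ex1: "\<exists>!x::real. 0 \<le> x \<and> x \<le> 1 \<and> x ^ (p - 1) + x - 1 = 0"
    using assms by (intro ex1_root) auto
  have root: "0 \<le> alpha p \<and> alpha p \<le> 1 \<and> alpha p ^ (p - 1) + alpha p - 1 = 0"
    unfolding alpha_def by (rule theI'[OF ex1])
  have "complement_power (p - 1) x = x
      \<longleftrightarrow> 0 \<le> 1 - x \<and> 1 - x \<le> 1 \<and> (1 - x) ^ (p - 1) + (1 - x) - 1 = 0"
    using assms by (auto simp: complement_power_def)
  also have "\<dots> \<longleftrightarrow> 1 - x = alpha p"
  proof
    assume "0 \<le> 1 - x \<and> 1 - x \<le> 1 \<and> (1 - x) ^ (p - 1) + (1 - x) - 1 = 0"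
    then show "1 - x = alpha p"
      unfolding alpha_def by (rule the1_equality[OF ex1, symmetric])
  qed (use root in simp)
  finally show ?thesis by auto
qed

section \<open>The derived system\<close>

lemma derived_system_regular:
  assumes "k \<in> {1..p}"
  shows "derived_system p (\<lambda>_. t) m k = (complement_power (p - 1) ^^ m) t"
  using assms
proof (induction m arbitrary: k)
  case (Suc m)
  have "derived_system p (\<lambda>_. t) (Suc m) k
      = (\<Prod>i\<in>{1..p} - {k}. 1 - (complement_power (p - 1) ^^ m) t)"
    by (simp only: derived_system.simps, intro prod.cong refl) (simp add: Suc.IH)
  also have "\<dots> = (complement_power (p - 1) ^^ Suc m) t"
    using Suc.prems by (simp add: complement_power_def)
  finally show ?case .
qed simp

theorem mainTheorem2:
  fixes p :: nat and A :: "nat \<Rightarrow> 'a::euclidean_space" and t :: real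
  assumes "p \<ge> 3"
    and "inj_on A {1..p}"
    and "0 < t" and "t < 1"
  shows "dual_seq p (\<lambda>_. t) A \<longlonglongrightarrow> centroid p A \<and>
    (\<exists>!x::real. 0 \<le> x \<and> x \<le> 1 \<and> x ^ (p - 1) + x - 1 = 0) \<and>
    (let T = derived_system p (\<lambda>_. t) in
      (t = 1 - alpha p \<longrightarrow> (\<forall>m. \<forall>k\<in>{1..p}. T m k = 1 - alpha p)) \<and>
      (t \<noteq> 1 - alpha p \<longrightarrow>
        \<not> (\<exists>v. tuple_tendsto p T v) \<and>
        (\<forall>m. \<forall>k\<in>{1..p}. \<forall>j\<in>{1..p}. T m k = T m j) \<and>
        (\<exists>l\<in>{0, 1}.
          (\<forall>k\<in>{1..p}. (\<lambda>m. T (2 * m) k) \<longlonglongrightarrow> l) \<and>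
          (\<forall>k\<in>{1..p}. (\<lambda>m. T (2 * m + 1) k) \<longlonglongrightarrow> 1 - l)) \<and>
        ((\<forall>k\<in>{1..p}. incseq (\<lambda>m. T (2 * m) k) \<and> decseq (\<lambda>m. T (2 * m + 1) k)) \<or>
         (\<forall>k\<in>{1..p}. decseq (\<lambda>m. T (2 * m) k) \<and> incseq (\<lambda>m. T (2 * m + 1) k)))))"
proof -
  define f where "f = complement_power (p - 1)"
  define T where "T = derived_system p (\<lambda>_. t)"
  have p: "p \<ge> 1" "p \<ge> 2" "p - 1 \<ge> 1" "p - 1 \<ge> 2" using assms(1) by auto
  have T: "T m k = (f ^^ m) t" if "k \<in> {1..p}" for m k
    using derived_system_regular[OF that] by (simp add: T_def f_def)
  have unit: "0 < (f ^^ m) t" "(f ^^ m) t < 1" for m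
    using complement_power_iterate_in_unit[OF assms(3,4) p(3)] by (auto simp: f_def)
  have "dual_seq p (\<lambda>_. t) A m = centroid p A" for m
    unfolding dual_seq_def
    using regular_barypolygonal_limit[OF p(1) _ unit[of m], of "T m"] T by (simp add: T_def)
  then have dual: "dual_seq p (\<lambda>_. t) A \<longlonglongrightarrow> centroid p A"
    by (intro tendsto_eventually) simp
  have fixed: "f t = t \<longleftrightarrow> t = 1 - alpha p"
    using complement_power_eq_iff_alpha[OF p(2) assms(3,4)] by (simp add: f_def)
  have stationary: "T m k = 1 - alpha p" if "t = 1 - alpha p" "k \<in> {1..p}" for m k
  proof -
    have "(f ^^ m) t = t" using fixed that(1) by (induction m) auto
    then show ?thesis using T that by simp
  qed
  have odd_lim: "(\<lambda>m. (f ^^ (2 * m + 1)) t) \<longlonglongrightarrow> 1 - l"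
    if "(\<lambda>m. (f ^^ (2 * m)) t) \<longlonglongrightarrow> l" "l \<in> {0, 1}" for l
  proof -
    have "f l = 1 - l" using that(2) p by (auto simp: f_def complement_power_def)
    then show ?thesis
      using tendsto_complement_power[OF that(1), of "p - 1"] by (simp add: f_def)
  qed
  have odd_mono: "f ((f ^^ (2 * n)) t) \<le> f ((f ^^ (2 * m)) t)"
    if "(f ^^ (2 * m)) t \<le> (f ^^ (2 * n)) t" for m n
    using that unit(2)[of "2 * n"] by (simp add: f_def complement_power_antimono)
  have nonstationary: "\<not> (\<exists>v. tuple_tendsto p T v) \<and>
        (\<exists>l\<in>{0, 1}.
          (\<forall>k\<in>{1..p}. (\<lambda>m. T (2 * m) k) \<longlonglongrightarrow> l) \<and>
          (\<forall>k\<in>{1..p}. (\<lambda>m. T (2 * m + 1) k) \<longlonglongrightarrow> 1 - l)) \<and>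
        ((\<forall>k\<in>{1..p}. incseq (\<lambda>m. T (2 * m) k) \<and> decseq (\<lambda>m. T (2 * m + 1) k)) \<or>
         (\<forall>k\<in>{1..p}. decseq (\<lambda>m. T (2 * m) k) \<and> incseq (\<lambda>m. T (2 * m + 1) k)))"
    if "t \<noteq> 1 - alpha p"
  proof -
    have even: "\<exists>l\<in>{0, 1}. (\<lambda>m. (f ^^ (2 * m)) t) \<longlonglongrightarrow> l"
      "incseq (\<lambda>m. (f ^^ (2 * m)) t) \<or> decseq (\<lambda>m. (f ^^ (2 * m)) t)"
      using that fixed even_iterates_below[OF assms(3,4) p(4)]
        even_iterates_above[OF assms(3,4) p(4)]
      by (cases "t < f t"; force simp: f_def)+
    then obtain l where l: "l \<in> {0, 1}" "(\<lambda>m. (f ^^ (2 * m)) t) \<longlonglongrightarrow> l" by blast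
    have lims: "(\<lambda>m. T (2 * m) k) \<longlonglongrightarrow> l" "(\<lambda>m. T (2 * m + 1) k) \<longlonglongrightarrow> 1 - l"
      if "k \<in> {1..p}" for k
      using l odd_lim[OF l(2,1)] T[OF that] by simp_all
    have "\<not> tuple_tendsto p T v" for v
    proof
      assume "tuple_tendsto p T v"
      moreover have one: "1 \<in> {1..p}" using p by simp
      ultimately have v: "(\<lambda>m. T m 1) \<longlonglongrightarrow> v 1" unfolding tuple_tendsto_def by blast
      have "(\<lambda>m. T (2 * m) 1) \<longlonglongrightarrow> v 1" "(\<lambda>m. T (2 * m + 1) 1) \<longlonglongrightarrow> v 1"
        using LIMSEQ_subseq_LIMSEQ[OF v, of "\<lambda>m. 2 * m"]
          LIMSEQ_subseq_LIMSEQ[OF v, of "\<lambda>m. 2 * m + 1"]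
        by (simp_all add: strict_mono_def o_def)
      then have "l = 1 - l"
        using LIMSEQ_unique lims[OF one] by blast
      then show False using l(1) by auto
    qed
    moreover have "incseq (\<lambda>m. T (2 * m) k) \<and> decseq (\<lambda>m. T (2 * m + 1) k)"
      if "incseq (\<lambda>m. (f ^^ (2 * m)) t)" "k \<in> {1..p}" for k
      using that odd_mono by (simp add: T monotone_def)
    moreover have "decseq (\<lambda>m. T (2 * m) k) \<and> incseq (\<lambda>m. T (2 * m + 1) k)"
      if "decseq (\<lambda>m. (f ^^ (2 * m)) t)" "k \<in> {1..p}" for k
      using that odd_mono by (simp add: T monotone_def)
    ultimately show ?thesis using even(2) l(1) lims by blast
  qed
  show ?thesis
    unfolding Let_def T_def[symmetric]
    using dual ex1_root[OF p(3)] stationary nonstationary T by simp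
qed

end
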